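(* For integers $L\ge 3$, $s\ge 1$, $r\ge 0$ and $k_1>k_2\ge 1$, the power series \[ H^*_{L,s,r,k_1,k_2}(q):=\frac{q^r(1-q^{k_1})-(1-q^{k_2})}{(q^s;q)_{L+1}} \] is eventually positive.
   Context: $(a;q)_n=(1-a)(1-aq)\cdots(1-aq^{n-1})$, and the quotient is expanded as a formal power series in $q$. A series $\sum_{n\ge 0}a_nq^n\in\mathbb{R}[[q]]$ is called eventually positive if there exists an integer $M\ge 0$ such that $a_n>0$ for all $n>M$. *)

theory Defs
  imports "HOL-Computational_Algebra.Formal_Power_Series"
begin

definition qpochhammer :: "'a::comm_ring_1 \<Rightarrow> 'a \<Rightarrow> nat \<Rightarrow> 'a" where
  "qpochhammer a q n = (\<Prod>i<n. 1 - a * q ^ i)"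

definition eventually_positive :: "real fps \<Rightarrow> bool" where
  "eventually_positive f \<longleftrightarrow> (\<exists>M::nat. \<forall>n>M. fps_nth f n > 0)"

(* For s \<ge> 1 the denominator has constant coefficient 1, hence is a unit, so the
   division is the usual expansion of the quotient as a power series in q. *)
definition Hstar :: "nat \<Rightarrow> nat \<Rightarrow> nat \<Rightarrow> nat \<Rightarrow> nat \<Rightarrow> real fps" where
  "Hstar L s r k1 k2 =
     (fps_X ^ r * (1 - fps_X ^ k1) - (1 - fps_X ^ k2)) / qpochhammer (fps_X ^ s) fps_X (L + 1)"

end

theory Submission
  imports Defs
begin

text \<open>
  The identity (1 - q^(a+1)) - q (1 - q^a) = 1 - q gives
  1 / ((1 - q^a) (1 - q^(a+1))) = (1 / (1 - q^a) - q / (1 - q^(a+1))) / (1 - q),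
  whose coefficients are differences of floor functions. Hence this series equals
  c / (1 - q)^2 with c = 1 / (a (a+1)), up to bounded coefficients. Applying this with
  a = s and a = s + 2, the coefficients of (1 - q) / (q^s; q)_4 are C n^2 + O(n) with C > 0.
  For L = 3 the series is this one times a polynomial whose value at q = 1 is k1 - k2 > 0,
  so its coefficients tend to infinity. Dividing by a further factor 1 - q^j replaces
  coefficients by sums along a residue class mod j, which preserves divergence to infinity.
\<close>

section \<open>Growth of coefficient sequences\<close>

definition poly_bounded :: "nat \<Rightarrow> real fps \<Rightarrow> bool" where
  "poly_bounded k f \<longleftrightarrow> (\<exists>C\<ge>0. \<forall>n. \<bar>fps_nth f n\<bar> \<le> C * (real n + 1) ^ k)"

text \<open>Only the leading constant \<open>c\<close> is tracked, with an O(n) error. The case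
  \<open>c = 0\<close> absorbs all linearly bounded remainders.\<close>

definition quadratic_growth :: "real \<Rightarrow> real fps \<Rightarrow> bool" where
  "quadratic_growth c f \<longleftrightarrow> (\<exists>C\<ge>0. \<forall>n. \<bar>fps_nth f n - c * (real n)\<^sup>2\<bar> \<le> C * (real n + 1))"

lemma poly_bounded_add:
  assumes "poly_bounded k f" "poly_bounded k g"
  shows "poly_bounded k (f + g)"
proof -
  obtain C D where C: "C \<ge> 0" "\<And>n. \<bar>fps_nth f n\<bar> \<le> C * (real n + 1) ^ k"
    and D: "D \<ge> 0" "\<And>n. \<bar>fps_nth g n\<bar> \<le> D * (real n + 1) ^ k"
    using assms unfolding poly_bounded_def by blast
  have "\<bar>fps_nth (f + g) n\<bar> \<le> (C + D) * (real n + 1) ^ k" for n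
    using C(2)[of n] D(2)[of n] by (simp add: distrib_right)
  then show ?thesis
    unfolding poly_bounded_def using C(1) D(1) by (intro exI[of _ "C + D"]) auto
qed

lemma poly_bounded_const_mult:
  assumes "poly_bounded k f"
  shows "poly_bounded k (fps_const c * f)"
proof -
  obtain C where C: "C \<ge> 0" "\<And>n. \<bar>fps_nth f n\<bar> \<le> C * (real n + 1) ^ k"
    using assms unfolding poly_bounded_def by blast
  have "\<bar>fps_nth (fps_const c * f) n\<bar> \<le> (\<bar>c\<bar> * C) * (real n + 1) ^ k" for n
    using mult_left_mono[OF C(2)[of n], of "\<bar>c\<bar>"] by (simp add: abs_mult mult.assoc)
  then show ?thesis
    unfolding poly_bounded_def using C(1) by (intro exI[of _ "\<bar>c\<bar> * C"]) auto
qed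

lemma poly_bounded_diff:
  assumes "poly_bounded k f" "poly_bounded k g"
  shows "poly_bounded k (f - g)"
  using poly_bounded_add[OF assms(1) poly_bounded_const_mult[OF assms(2), of "-1"]]
  by (simp flip: fps_const_neg)

lemma poly_bounded_X_mult:
  assumes "poly_bounded k f"
  shows "poly_bounded k (fps_X * f)"
proof -
  obtain C where C: "C \<ge> 0" "\<And>n. \<bar>fps_nth f n\<bar> \<le> C * (real n + 1) ^ k"
    using assms unfolding poly_bounded_def by blast
  have "\<bar>fps_nth (fps_X * f) n\<bar> \<le> C * (real n + 1) ^ k" for n
  proof (cases n)
    case 0
    then show ?thesis using C(1) by simp
  next
    case (Suc m)
    have "C * (real m + 1) ^ k \<le> C * (real n + 1) ^ k"
      using C(1) Suc by (intro mult_left_mono power_mono) auto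
    then show ?thesis using C(2)[of m] Suc by simp
  qed
  then show ?thesis
    unfolding poly_bounded_def using C(1) by blast
qed

text \<open>The Cauchy product at index n has n + 1 terms, each at most the product of the two
  bounds.\<close>

lemma poly_bounded_mult:
  assumes "poly_bounded 0 f" "poly_bounded 0 g"
  shows "poly_bounded 1 (f * g)"
proof -
  obtain C D where C: "C \<ge> 0" "\<And>n. \<bar>fps_nth f n\<bar> \<le> C"
    and D: "D \<ge> 0" "\<And>n. \<bar>fps_nth g n\<bar> \<le> D"
    using assms unfolding poly_bounded_def by auto
  have "\<bar>fps_nth (f * g) n\<bar> \<le> (C * D) * (real n + 1) ^ 1" for n
  proof -
    have "\<bar>fps_nth (f * g) n\<bar> \<le> (\<Sum>i=0..n. \<bar>fps_nth f i * fps_nth g (n - i)\<bar>)"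
      unfolding fps_mult_nth by (rule sum_abs)
    also have "\<dots> \<le> (\<Sum>i=0..n. C * D)"
      unfolding abs_mult using C D by (intro sum_mono mult_mono) auto
    finally show ?thesis by (simp add: algebra_simps)
  qed
  then show ?thesis
    unfolding poly_bounded_def using C(1) D(1) by (intro exI[of _ "C * D"]) auto
qed

lemma quadratic_growth_add:
  assumes "quadratic_growth c f" "quadratic_growth d g"
  shows "quadratic_growth (c + d) (f + g)"
proof -
  obtain C D where C: "C \<ge> 0" "\<And>n. \<bar>fps_nth f n - c * (real n)\<^sup>2\<bar> \<le> C * (real n + 1)"
    and D: "D \<ge> 0" "\<And>n. \<bar>fps_nth g n - d * (real n)\<^sup>2\<bar> \<le> D * (real n + 1)"
    using assms unfolding quadratic_growth_def by blast
  have "\<bar>fps_nth (f + g) n - (c + d) * (real n)\<^sup>2\<bar> \<le> (C + D) * (real n + 1)" for n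
    using C(2)[of n] D(2)[of n] unfolding fps_add_nth distrib_right by linarith
  then show ?thesis
    unfolding quadratic_growth_def using C(1) D(1) by (intro exI[of _ "C + D"]) auto
qed

lemma quadratic_growth_const_mult:
  assumes "quadratic_growth c f"
  shows "quadratic_growth (d * c) (fps_const d * f)"
proof -
  obtain C where C: "C \<ge> 0" "\<And>n. \<bar>fps_nth f n - c * (real n)\<^sup>2\<bar> \<le> C * (real n + 1)"
    using assms unfolding quadratic_growth_def by blast
  have "\<bar>fps_nth (fps_const d * f) n - (d * c) * (real n)\<^sup>2\<bar> \<le> (\<bar>d\<bar> * C) * (real n + 1)" for n
  proof -
    have "fps_nth (fps_const d * f) n - (d * c) * (real n)\<^sup>2 = d * (fps_nth f n - c * (real n)\<^sup>2)"
      by (simp add: algebra_simps)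
    then show ?thesis
      using mult_left_mono[OF C(2)[of n], of "\<bar>d\<bar>"] by (simp add: abs_mult mult.assoc)
  qed
  then show ?thesis
    unfolding quadratic_growth_def using C(1) by (intro exI[of _ "\<bar>d\<bar> * C"]) auto
qed

lemma quadratic_growth_diff:
  assumes "quadratic_growth c f" "quadratic_growth d g"
  shows "quadratic_growth (c - d) (f - g)"
  using quadratic_growth_add[OF assms(1) quadratic_growth_const_mult[OF assms(2), of "-1"]]
  by (simp flip: fps_const_neg)

lemma quadratic_growth_poly_bounded:
  assumes "poly_bounded 1 f"
  shows "quadratic_growth 0 f"
  using assms unfolding poly_bounded_def quadratic_growth_def by simp

text \<open>Since n^2 - (n - 1)^2 = 2n - 1, a shift changes the leading term only by an amount that
  fits into the linear error.\<close>

lemma quadratic_growth_X_mult: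
  assumes "quadratic_growth c f"
  shows "quadratic_growth c (fps_X * f)"
proof -
  obtain C where C: "C \<ge> 0" "\<And>n. \<bar>fps_nth f n - c * (real n)\<^sup>2\<bar> \<le> C * (real n + 1)"
    using assms unfolding quadratic_growth_def by blast
  have "\<bar>fps_nth (fps_X * f) n - c * (real n)\<^sup>2\<bar> \<le> (C + 2 * \<bar>c\<bar>) * (real n + 1)" for n
  proof (cases n)
    case 0
    then show ?thesis using C(1) by simp
  next
    case (Suc m)
    have "fps_nth (fps_X * f) n - c * (real n)\<^sup>2 =
        (fps_nth f m - c * (real m)\<^sup>2) - c * (2 * real m + 1)"
      using Suc by (simp add: algebra_simps power2_eq_square)
    moreover have "\<bar>c * (2 * real m + 1)\<bar> = \<bar>c\<bar> * (2 * real m + 1)"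
      by (simp add: abs_mult)
    ultimately have "\<bar>fps_nth (fps_X * f) n - c * (real n)\<^sup>2\<bar>
        \<le> C * (real m + 1) + \<bar>c\<bar> * (2 * real m + 1)"
      using C(2)[of m] by linarith
    also have "\<dots> \<le> C * (real n + 1) + \<bar>c\<bar> * (2 * (real n + 1))"
      using C(1) Suc by (intro add_mono mult_left_mono) auto
    finally show ?thesis by (simp add: algebra_simps)
  qed
  then show ?thesis
    unfolding quadratic_growth_def using C(1) by (intro exI[of _ "C + 2 * \<bar>c\<bar>"]) auto
qed

lemma quadratic_growth_X_power_mult:
  assumes "quadratic_growth c f"
  shows "quadratic_growth c (fps_X ^ k * f)"
  by (induction k) (auto simp: assms mult.assoc intro: quadratic_growth_X_mult)

text \<open>Each of the k shifted copies of \<open>f\<close> contributes the same leading constant;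
  the factor k is the value of the polynomial at q = 1.\<close>

lemma quadratic_growth_geometric_sum_mult:
  assumes "quadratic_growth c f"
  shows "quadratic_growth (real k * c) ((\<Sum>i<k. fps_X ^ i) * f)"
proof (induction k)
  case 0
  show ?case by (auto simp: quadratic_growth_def)
next
  case (Suc k)
  show ?case
    using quadratic_growth_add[OF Suc quadratic_growth_X_power_mult[OF assms, of k]]
    by (simp add: algebra_simps)
qed

lemma quadratic_growth_at_top:
  assumes "quadratic_growth c f" "c > 0"
  shows "filterlim (fps_nth f) at_top sequentially"
proof -
  obtain C where C: "C \<ge> 0" "\<And>n. \<bar>fps_nth f n - c * (real n)\<^sup>2\<bar> \<le> C * (real n + 1)"
    using assms unfolding quadratic_growth_def by blast
  \<comment> \<open>Beyond this threshold c n^2 \<ge> (C + 1) n, so removing the error C (n + 1)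
    still leaves n - C.\<close>
  have *: "real n - C \<le> fps_nth f n" if "n \<ge> nat \<lceil>(C + 1) / c\<rceil>" for n
  proof -
    have "(C + 1) / c \<le> real n" using that by linarith
    then have "C + 1 \<le> c * real n" using assms(2) by (simp add: field_simps)
    then have "(C + 1) * real n \<le> c * real n * real n" by (intro mult_right_mono) auto
    then show ?thesis using C(2)[of n] by (simp add: power2_eq_square algebra_simps abs_le_iff)
  qed
  have "filterlim (\<lambda>n. - C + real n) at_top sequentially"
    by (rule filterlim_tendsto_add_at_top[OF tendsto_const filterlim_real_sequentially])
  then show ?thesis
    by (rule filterlim_at_top_mono)
      (use * in \<open>auto simp: eventually_at_top_linorder intro!: exI[of _ "nat \<lceil>(C + 1) / c\<rceil>"]\<close>)
qed

section \<open>Explicit expansions and pairs of consecutive factors\<close>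

text \<open>\<open>geom0\<close>, \<open>geom1\<close>, \<open>geom2\<close> are 1/(1 - q), 1/(1 -
  q)^2, 1/(1 - q)^3, given by their coefficients so that growth can be read off.\<close>

definition geom0 :: "real fps" where "geom0 = Abs_fps (\<lambda>_. 1)"
definition geom1 :: "real fps" where "geom1 = Abs_fps (\<lambda>n. real n + 1)"
definition geom2 :: "real fps" where "geom2 = Abs_fps (\<lambda>n. (real n + 1) * (real n + 2) / 2)"

lemma geom0: "(1 - fps_X) * geom0 = 1"
  by (rule fps_ext) (auto simp: geom0_def left_diff_distrib)

lemma poly_bounded_geom0: "poly_bounded 0 geom0"
  unfolding poly_bounded_def geom0_def by (intro exI[of _ 1]) simp

lemma geom1: "(1 - fps_X) * geom1 = geom0"
  by (rule fps_ext) (auto simp: geom0_def geom1_def left_diff_distrib of_nat_diff)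

lemma geom2: "(1 - fps_X) * geom2 = geom1"
proof (rule fps_ext)
  fix n show "fps_nth ((1 - fps_X) * geom2) n = fps_nth geom1 n"
    by (cases n) (auto simp: geom1_def geom2_def left_diff_distrib field_simps)
qed

text \<open>The expansion of 1/((1 - q)(1 - q^a)): the coefficient counts the multiples of a in
  {0..n}.\<close>

definition floor_series :: "nat \<Rightarrow> real fps" where
  "floor_series a = Abs_fps (\<lambda>n. real (n div a) + 1)"

lemma floor_series:
  assumes "a \<ge> 1"
  shows "(1 - fps_X ^ a) * floor_series a = geom0"
proof (rule fps_ext)
  fix n show "fps_nth ((1 - fps_X ^ a) * floor_series a) n = fps_nth geom0 n"
    using assms
    by (auto simp: geom0_def floor_series_def left_diff_distrib fps_X_power_mult_nth le_div_geq)
qed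

text \<open>Replacing \<open>n div a\<close> by n/a costs at most 1, and the remaining constant 1 -
  1/a lies between 0 and 1.\<close>

lemma poly_bounded_floor_series:
  assumes "a \<ge> 1"
  shows "poly_bounded 0 (floor_series a - fps_const (1 / real a) * geom1)"
proof -
  have "\<bar>real (n div a) + 1 - 1 / real a * (real n + 1)\<bar> \<le> 2" for n
  proof -
    have "real n / real a - real (n div a) \<in> {0..1}"
      using floor_divide_of_nat_eq[of n a, where ?'a = real] by simp linarith
    moreover have "0 \<le> 1 / real a" "1 / real a \<le> 1" using assms by simp_all
    moreover have "1 / real a * (real n + 1) = real n / real a + 1 / real a"
      by (simp add: add_divide_distrib)
    ultimately show ?thesis unfolding atLeastAtMost_iff by linarith
  qed
  then show ?thesis
    unfolding poly_bounded_def floor_series_def geom1_def by (intro exI[of _ 2]) simp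
qed

text \<open>The expansion of 1/((1 - q^a)(1 - q^(a+1))) in the split form, with the common factor
  1/(1 - q) absorbed into the floor series.\<close>

definition pair_series :: "nat \<Rightarrow> real fps" where
  "pair_series a = floor_series a - fps_X * floor_series (a + 1)"

lemma pair_series:
  assumes "a \<ge> 1"
  shows "(1 - fps_X ^ a) * (1 - fps_X ^ (a + 1)) * pair_series a = 1"
proof -
  have "(1 - fps_X ^ a) * (1 - fps_X ^ (a + 1)) * pair_series a =
      (1 - fps_X ^ (a + 1)) * ((1 - fps_X ^ a) * floor_series a) -
      fps_X * (1 - fps_X ^ a) * ((1 - fps_X ^ (a + 1)) * floor_series (a + 1))"
    unfolding pair_series_def by algebra
  \<comment> \<open>Both floor series collapse to \<open>geom0\<close>, and (1 - q^(a+1)) - q (1 -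
    q^a) = 1 - q remains.\<close>
  also have "\<dots> = (1 - fps_X) * geom0"
    using assms by (simp add: floor_series del: power_Suc) (simp add: algebra_simps)
  finally show ?thesis by (simp add: geom0)
qed

lemma pair_series_decomp:
  assumes "a \<ge> 1"
  obtains c B where "c > 0" "poly_bounded 0 B" "pair_series a = fps_const c * geom1 + B"
proof
  define c where "c = 1 / real a - 1 / real (a + 1)"
  show "c > 0" using assms by (simp add: c_def field_simps add_pos_nonneg)
  \<comment> \<open>The last summand corrects for the shift: q \<open>geom1\<close> =
    \<open>geom1\<close> - \<open>geom0\<close>.\<close>
  define B where "B = (floor_series a - fps_const (1 / real a) * geom1)
    - fps_X * (floor_series (a + 1) - fps_const (1 / real (a + 1)) * geom1)
    + fps_const (1 / real (a + 1)) * geom0"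
  show "poly_bounded 0 B"
    unfolding B_def using assms poly_bounded_geom0
    by (intro poly_bounded_add poly_bounded_diff poly_bounded_X_mult poly_bounded_const_mult
        poly_bounded_floor_series) auto
  have c: "fps_const c = fps_const (1 / real a) - fps_const (1 / real (a + 1))"
    by (simp add: c_def)
  show "pair_series a = fps_const c * geom1 + B"
    unfolding pair_series_def B_def c geom1[symmetric] by algebra
qed

text \<open>The two double poles times 1 - q give a multiple of \<open>geom2\<close>, with
  coefficients n^2/2 + O(n). In each remaining term, 1 - q lowers a \<open>geom1\<close> to
  \<open>geom0\<close> or acts on a bounded series, leaving a product of two bounded series, hence
  O(n).\<close>

lemma quadratic_growth_pair_series_product:
  assumes "a \<ge> 1" "b \<ge> 1"
  obtains c where "c > 0" "quadratic_growth c ((1 - fps_X) * pair_series a * pair_series b)"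
proof -
  obtain c B where c: "c > 0" "poly_bounded 0 B" "pair_series a = fps_const c * geom1 + B"
    using pair_series_decomp[OF assms(1)] .
  obtain d D where d: "d > 0" "poly_bounded 0 D" "pair_series b = fps_const d * geom1 + D"
    using pair_series_decomp[OF assms(2)] .
  have cube: "(1 - fps_X) * geom1 * geom1 = geom2"
    using geom0 geom1 geom2 by algebra
  have "(1 - fps_X) * pair_series a * pair_series b =
      fps_const c * fps_const d * ((1 - fps_X) * geom1 * geom1) +
      (fps_const c * (((1 - fps_X) * geom1) * D) + fps_const d * (((1 - fps_X) * geom1) * B)
       + (B - fps_X * B) * D)"
    unfolding c(3) d(3) by algebra
  also have "\<dots> = fps_const (c * d) * geom2 +
      (fps_const c * (geom0 * D) + fps_const d * (geom0 * B) + (B - fps_X * B) * D)"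
    by (subst cube) (simp only: geom1 fps_const_mult)
  finally have eq: "(1 - fps_X) * pair_series a * pair_series b = \<dots>" .
  have "quadratic_growth (1 / 2) geom2"
    unfolding quadratic_growth_def geom2_def
    by (intro exI[of _ 2]) (auto simp: power2_eq_square field_simps)
  then have "quadratic_growth (c * d * (1 / 2) + 0) ((1 - fps_X) * pair_series a * pair_series b)"
    unfolding eq
    by (intro quadratic_growth_add quadratic_growth_const_mult quadratic_growth_poly_bounded
        poly_bounded_add poly_bounded_const_mult poly_bounded_mult poly_bounded_diff
        poly_bounded_X_mult c d poly_bounded_geom0)
  then show ?thesis using that[of "c * d * (1 / 2) + 0"] c(1) d(1) by simp
qed

section \<open>Divergence under division by 1 - q^j\<close>

lemma at_top_of_one_minus_X_power_mult:
  fixes f g :: "real fps"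
  assumes lim: "filterlim (fps_nth f) at_top sequentially"
    and eq: "(1 - fps_X ^ j) * g = f" and j: "j \<ge> 1"
  shows "filterlim (fps_nth g) at_top sequentially"
proof -
  have rec: "fps_nth g n = fps_nth f n + fps_nth g (n - j)" if "n \<ge> j" for n
    using that unfolding eq[symmetric] by (simp add: left_diff_distrib fps_X_power_mult_nth)
  have "\<forall>\<^sub>F n in sequentially. fps_nth f n \<ge> 1"
    using lim by (simp add: filterlim_at_top)
  then obtain N where N: "\<And>n. n \<ge> N \<Longrightarrow> fps_nth f n \<ge> 1"
    by (auto simp: eventually_at_top_linorder)
  \<comment> \<open>For n \<ge> N + j the recurrence adds at least 1 to an earlier coefficient, so
    the minimum over this initial window bounds all coefficients of \<open>g\<close> from
    below.\<close>
  define m where "m = Min (fps_nth g ` {..<N + j})"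
  have m: "fps_nth g n \<ge> m" for n
  proof (induction n rule: less_induct)
    case (less n)
    show ?case
    proof (cases "n < N + j")
      case True
      then show ?thesis unfolding m_def by (intro Min_le) auto
    next
      case False
      then show ?thesis using less[of "n - j"] N[of n] rec[of n] j by fastforce
    qed
  qed
  \<comment> \<open>For n \<ge> j the recurrence and the bound m on the earlier coefficient put
    \<open>g\<close> above m + \<open>f\<close>.\<close>
  have "filterlim (\<lambda>n. m + fps_nth f n) at_top sequentially"
    by (rule filterlim_tendsto_add_at_top[OF tendsto_const lim])
  then show ?thesis
    by (rule filterlim_at_top_mono)
      (use m rec in \<open>auto simp: eventually_at_top_linorder intro!: exI[of _ j]\<close>)
qed

section \<open>The q-Pochhammer denominator and the series \<open>Hstar\<close>\<close>

lemma qpochhammer_Suc: "qpochhammer a q (Suc n) = qpochhammer a q n * (1 - a * q ^ n)"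
  by (simp add: qpochhammer_def)

lemma qpochhammer_X_power_nth_0:
  assumes "s \<ge> 1"
  shows "fps_nth (qpochhammer (fps_X ^ s) fps_X n :: real fps) 0 = 1"
  using assms by (induction n) (auto simp: qpochhammer_Suc qpochhammer_def)

text \<open>The denominator has constant coefficient 1 and is therefore a unit; this
  cross-multiplied form replaces the division in what follows.\<close>

lemma qpochhammer_mult_Hstar:
  assumes "s \<ge> 1"
  shows "qpochhammer (fps_X ^ s) fps_X (L + 1) * Hstar L s r k1 k2 =
    fps_X ^ r * (1 - fps_X ^ k1) - (1 - fps_X ^ k2)"
proof -
  let ?D = "qpochhammer (fps_X ^ s) fps_X (L + 1) :: real fps"
  have "fps_nth ?D 0 \<noteq> 0" using qpochhammer_X_power_nth_0[OF assms, of "L + 1"] by simp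
  then show ?thesis
    unfolding Hstar_def by (simp add: fps_divide_unit inverse_mult_eq_1' mult.left_commute)
qed

lemma Hstar_3_at_top:
  assumes "s \<ge> 1" "k1 > k2"
  shows "filterlim (fps_nth (Hstar 3 s r k1 k2)) at_top sequentially"
proof -
  let ?N = "fps_X ^ r * (1 - fps_X ^ k1) - (1 - fps_X ^ k2) :: real fps"
  let ?D = "qpochhammer (fps_X ^ s) fps_X (3 + 1) :: real fps"
  let ?G = "(1 - fps_X) * pair_series s * pair_series (s + 2)"
  let ?S = "\<lambda>k. (\<Sum>i<k. fps_X ^ i) :: real fps"
  obtain c where c: "c > 0" "quadratic_growth c ?G"
    using quadratic_growth_pair_series_product[of s "s + 2"] assms by auto
  \<comment> \<open>The four factors form two pairs with consecutive exponents, starting at s and s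
    + 2.\<close>
  have D: "?D = ((1 - fps_X ^ s) * (1 - fps_X ^ (s + 1)))
      * ((1 - fps_X ^ (s + 2)) * (1 - fps_X ^ (s + 2 + 1)))"
    by (simp add: qpochhammer_def numeral_eq_Suc mult.assoc power_add del: power_Suc)
      (simp add: algebra_simps)
  have DP: "?D * (pair_series s * pair_series (s + 2)) = 1"
  proof -
    have "?D * (pair_series s * pair_series (s + 2)) =
      ((1 - fps_X ^ s) * (1 - fps_X ^ (s + 1)) * pair_series s)
      * ((1 - fps_X ^ (s + 2)) * (1 - fps_X ^ (s + 2 + 1)) * pair_series (s + 2))"
      unfolding D by (simp only: mult_ac)
    then show ?thesis using pair_series[of s] pair_series[of "s + 2"] assms by (simp only: mult_1_right)
  qed
  have "Hstar 3 s r k1 k2 = ?N * (pair_series s * pair_series (s + 2))"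
    unfolding qpochhammer_mult_Hstar[OF assms(1), of 3 r k1 k2, symmetric]
    using DP by (metis mult.commute mult.left_commute mult_1)
  \<comment> \<open>Each 1 - q^k in the numerator equals (1 - q) \<open>?S k\<close>; its factor 1 -
    q moves into \<open>?G\<close>.\<close>
  also have "\<dots> = fps_X ^ r * (?S k1 * ?G) - ?S k2 * ?G"
    unfolding one_diff_power_eq by (simp only: algebra_simps)
  finally have "Hstar 3 s r k1 k2 = \<dots>" .
  \<comment> \<open>The shift by r does not affect the leading constant, so (k1 - k2) c > 0
    results.\<close>
  moreover have "quadratic_growth (real k1 * c - real k2 * c) (fps_X ^ r * (?S k1 * ?G) - ?S k2 * ?G)"
    by (intro quadratic_growth_diff quadratic_growth_X_power_mult
        quadratic_growth_geometric_sum_mult c)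
  ultimately show ?thesis
    using quadratic_growth_at_top c(1) assms(2) by simp
qed

lemma Hstar_at_top:
  assumes "L \<ge> 3" "s \<ge> 1" "k1 > k2"
  shows "filterlim (fps_nth (Hstar L s r k1 k2)) at_top sequentially"
  using assms(1)
proof (induction L rule: dec_induct)
  case base
  show ?case using Hstar_3_at_top assms by simp
next
  case (step L)
  let ?D = "qpochhammer (fps_X ^ s) fps_X (L + 1) :: real fps"
  \<comment> \<open>Both sides equal the numerator, which does not depend on L. Passing to
    \<open>Suc L\<close> adds the single factor with index L + 1.\<close>
  have "?D * ((1 - fps_X ^ (s + (L + 1))) * Hstar (Suc L) s r k1 k2) = ?D * Hstar L s r k1 k2"
    using qpochhammer_mult_Hstar[OF assms(2), of "Suc L" r k1 k2]
      qpochhammer_mult_Hstar[OF assms(2), of L r k1 k2]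
    by (simp add: qpochhammer_Suc[of _ _ "Suc L"] power_add mult_ac)
  moreover have "?D \<noteq> 0"
    using qpochhammer_X_power_nth_0[OF assms(2), of "L + 1"] by auto
  ultimately have "(1 - fps_X ^ (s + (L + 1))) * Hstar (Suc L) s r k1 k2 = Hstar L s r k1 k2"
    by simp
  then show ?case
    by (rule at_top_of_one_minus_X_power_mult[OF step.IH]) simp
qed

theorem theorem1p2:
  fixes L s r k1 k2 :: nat
  assumes "L \<ge> 3" and "s \<ge> 1" and "r \<ge> 0" and "k1 > k2" and "k2 \<ge> 1"
  shows "eventually_positive (Hstar L s r k1 k2)"
proof -
  have "\<forall>\<^sub>F n in sequentially. fps_nth (Hstar L s r k1 k2) n \<ge> 1"
    using Hstar_at_top[of L s k2 k1 r] assms by (simp add: filterlim_at_top)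
  then obtain M where M: "\<And>n. n \<ge> M \<Longrightarrow> fps_nth (Hstar L s r k1 k2) n \<ge> 1"
    by (auto simp: eventually_at_top_linorder)
  have "fps_nth (Hstar L s r k1 k2) n > 0" if "n > M" for n
    using M[of n] that by linarith
  then show ?thesis unfolding eventually_positive_def by blast
qed

end
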